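(* Let $V$ be a valuation domain with quotient field $K$ and valuation $v$. Let $\phi\in K(X)$ be nonzero, let $s\in K$, and let $u$ be an extension of $v$ to $\overline{K}$. Let $\Delta$ be a convex subset of $\mathbb{Q}\Gamma_v$ such that $C=\mathcal{C}_u(s,\Delta)=\{t\in\overline{K}\mid u(t-s)\in\Delta\}$ does not contain any critical point of $\phi$. Let $S$ be the multiset of critical points $\alpha$ of $\phi$ which satisfy $u(\alpha-s)>\Delta$, let $\lambda\in\mathbb{Z}$ be the weighted sum of $S$, and let $\gamma=u\left(\frac{\phi}{\phi_S}(s)\right)$. Then, for all $t\in C\cap K$, we have $$v(\phi(t))=\lambda v(t-s)+\gamma.$$
   Context: $V$ is a valuation domain of arbitrary rank, with valuation $v$ and value group $\Gamma_v$ (written additively); $\overline{K}$ is a fixed algebraic closure of the quotient field $K$. Any extension $u$ of $v$ to $\overline{K}$ has value group $\mathbb{Q}\Gamma_v=\mathbb{Q}\otimes_{\mathbb{Z}}\Gamma_v$. For $\phi\in K(X)$, the multiset of critical points of $\phi$ is the multiset $\Omega_\phi$ of zeros and poles of $\phi$ in $\overline{K}$, each counted with multiplicity. For a sub-multiset $S=\{\alpha_1,\ldots,\alpha_k\}$ of $\Omega_\phi$, set $\epsilon_i=1$ if $\alpha_i$ is a zero of $\phi$ and $\epsilon_i=-1$ if $\alpha_i$ is a pole of $\phi$; the weighted sum of $S$ is $\sum_{\alpha_i\in S}\epsilon_i$, and the $S$-part of $\phi$ is $\phi_S(X)=\prod_{\alpha_i\in S}(X-\alpha_i)^{\epsilon_i}\in\overline{K}(X)$.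 For $\gamma\in\mathbb{Q}\Gamma_v\cup\{\infty\}$, $\gamma>\Delta$ means $\gamma>\delta$ for every $\delta\in\Delta$ (with $\infty$ larger than every element of $\mathbb{Q}\Gamma_v$). *)

theory Defs
  imports "HOL-Algebra.Algebraic_Closure_Type" "HOL-Library.Cancellation"
begin

section \<open>Ordered groups with a point at infinity\<close>

datatype 'g vinf = Val 'g | Infty

instantiation vinf :: (linorder) linorder
begin

fun less_eq_vinf :: "'a vinf \<Rightarrow> 'a vinf \<Rightarrow> bool" where
  "less_eq_vinf (Val a) (Val b) \<longleftrightarrow> a \<le> b"
| "less_eq_vinf Infty (Val b) \<longleftrightarrow> False"
| "less_eq_vinf _ Infty \<longleftrightarrow> True"

definition less_vinf :: "'a vinf \<Rightarrow> 'a vinf \<Rightarrow> bool" where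
  "less_vinf a b \<longleftrightarrow> a \<le> b \<and> \<not> b \<le> a"

instance
proof
  fix x y z :: "'a vinf"
  show "x < y \<longleftrightarrow> x \<le> y \<and> \<not> y \<le> x" by (simp add: less_vinf_def)
  show "x \<le> x" by (cases x) auto
  show "x \<le> y \<Longrightarrow> y \<le> z \<Longrightarrow> x \<le> z" by (cases x; cases y; cases z) auto
  show "x \<le> y \<Longrightarrow> y \<le> x \<Longrightarrow> x = y" by (cases x; cases y) auto
  show "x \<le> y \<or> y \<le> x" by (cases x; cases y) auto
qed

end

lemma less_vinf_simps [simp]:
  "Val a < Val b \<longleftrightarrow> a < b" "Val a < Infty" "\<not> Infty < x"
  by (auto simp: less_vinf_def)

instantiation vinf :: (linordered_ab_group_add) ordered_comm_monoid_add
begin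

definition zero_vinf :: "'a vinf" where "zero_vinf = Val 0"

fun plus_vinf :: "'a vinf \<Rightarrow> 'a vinf \<Rightarrow> 'a vinf" where
  "plus_vinf (Val a) (Val b) = Val (a + b)"
| "plus_vinf _ _ = Infty"

instance
proof
  fix a b c :: "'a vinf"
  show "a + b + c = a + (b + c)" by (cases a; cases b; cases c) (auto simp: add.assoc)
  show "a + b = b + a" by (cases a; cases b) (auto simp: add.commute)
  show "0 + a = a" by (cases a) (auto simp: zero_vinf_def)
  show "a \<le> b \<Longrightarrow> c + a \<le> c + b" by (cases a; cases b; cases c) auto
qed

end

definition int_mult :: "int \<Rightarrow> 'g::ab_group_add \<Rightarrow> 'g" where
  "int_mult n g = (if 0 \<le> n then iterate_add (nat n) g else - iterate_add (nat (- n)) g)"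

text \<open>Only the finite case is meaningful; the value at \<^const>\<open>Infty\<close> is a convention.\<close>

fun vinf_mult :: "int \<Rightarrow> 'g::ab_group_add vinf \<Rightarrow> 'g vinf" where
  "vinf_mult n (Val g) = Val (int_mult n g)"
| "vinf_mult n Infty = Infty"

section \<open>Valuations\<close>

definition is_valuation :: "('k::field \<Rightarrow> 'g::linordered_ab_group_add vinf) \<Rightarrow> bool" where
  "is_valuation v \<longleftrightarrow>
     (\<forall>x. v x = Infty \<longleftrightarrow> x = 0) \<and>
     (\<forall>x y. v (x * y) = v x + v y) \<and>
     (\<forall>x y. min (v x) (v y) \<le> v (x + y))"

text \<open>A valuation domain whose quotient field is the whole type.\<close>

definition valuation_domain :: "'k::field set \<Rightarrow> bool" where
  "valuation_domain V \<longleftrightarrow>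
     1 \<in> V \<and> (\<forall>x\<in>V. \<forall>y\<in>V. x - y \<in> V) \<and> (\<forall>x\<in>V. \<forall>y\<in>V. x * y \<in> V) \<and>
     (\<forall>x. x \<noteq> 0 \<longrightarrow> x \<in> V \<or> inverse x \<in> V)"

definition valuation_of ::
    "'k::field set \<Rightarrow> ('k \<Rightarrow> 'g::linordered_ab_group_add vinf) \<Rightarrow> bool" where
  "valuation_of V v \<longleftrightarrow> is_valuation v \<and> V = {x. 0 \<le> v x}"

definition value_group :: "('k::field \<Rightarrow> 'g::linordered_ab_group_add vinf) \<Rightarrow> 'g set" where
  "value_group v = {g. \<exists>x. v x = Val g}"

text \<open>
  The values lie in an ambient ordered group, in which the divisible hull
  of the value group is realised as the set of elements that have a positive multiple
  in the value group. The ambient group need not be divisible, but as soon as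
  \<open>v\<close> extends to the algebraic closure with values in it, this set is divisible
  (it is the value group of the extension), hence it is the tensor product of the value
  group with the rationals.
\<close>

definition rational_value_group ::
    "('k::field \<Rightarrow> 'g::linordered_ab_group_add vinf) \<Rightarrow> 'g set" where
  "rational_value_group v = {g. \<exists>n>0. iterate_add n g \<in> value_group v}"

definition extends_valuation ::
    "('k::field alg_closure \<Rightarrow> 'g::linordered_ab_group_add vinf) \<Rightarrow> ('k \<Rightarrow> 'g vinf) \<Rightarrow> bool" where
  "extends_valuation u v \<longleftrightarrow> is_valuation u \<and> (\<forall>x. u (to_ac x) = v x)"

definition convex_subset :: "'g::linorder set \<Rightarrow> 'g set \<Rightarrow> bool" where
  "convex_subset \<Delta> G \<longleftrightarrow>
     \<Delta> \<subseteq> G \<and> (\<forall>a\<in>\<Delta>. \<forall>b\<in>\<Delta>. \<forall>c\<in>G. a \<le> c \<and> c \<le> b \<longrightarrow> c \<in> \<Delta>)"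

definition above :: "'g::linorder vinf \<Rightarrow> 'g set \<Rightarrow> bool" where
  "above \<gamma> \<Delta> \<longleftrightarrow> (\<forall>\<delta>\<in>\<Delta>. Val \<delta> < \<gamma>)"

definition annulus ::
    "('k::field alg_closure \<Rightarrow> 'g vinf) \<Rightarrow> 'k \<Rightarrow> 'g set \<Rightarrow> 'k alg_closure set" where
  "annulus u s \<Delta> = {t. u (t - to_ac s) \<in> Val ` \<Delta>}"

section \<open>Rational functions\<close>

type_synonym 'k ratfun = "'k poly fract"

text \<open>The representation in lowest terms with monic denominator.\<close>

definition num_den :: "'k::field ratfun \<Rightarrow> 'k poly \<times> 'k poly" where
  "num_den r = (SOME (p, q). Rings.coprime p q \<and> lead_coeff q = 1 \<and> r = Fract p q)"

lemma num_den_exists: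
  fixes r :: "'k::field ratfun"
  shows "\<exists>p q. Rings.coprime p q \<and> lead_coeff q = 1 \<and> r = Fract p q"
proof -
  let ?P = "\<lambda>n. \<exists>p q. q \<noteq> 0 \<and> r = Fract p q \<and> degree q = n"
  have "\<exists>n. ?P n" by (cases r rule: Fract_cases) blast
  hence "?P (LEAST n. ?P n)" by (rule LeastI_ex)
  then obtain p q where q: "q \<noteq> 0" "r = Fract p q" and min: "degree q = (LEAST n. ?P n)"
    by blast
  have "Rings.coprime p q"
  proof (rule coprimeI)
    fix d assume "d dvd p" "d dvd q"
    then obtain p' q' where d: "p = d * p'" "q = d * q'" by (auto elim!: dvdE)
    with q have nz: "d \<noteq> 0" "q' \<noteq> 0" by auto
    with d q have "r = Fract p' q'" by (simp add: eq_fract algebra_simps)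
    with nz have "degree q \<le> degree q'" unfolding min by (intro Least_le) blast
    moreover have "degree q = degree d + degree q'" using nz d by (simp add: degree_mult_eq)
    ultimately show "is_unit d" using nz by (simp add: is_unit_iff_degree)
  qed
  define c where "c = inverse (lead_coeff q)"
  have c: "c \<noteq> 0" using q by (simp add: c_def)
  have "Rings.coprime (smult c p) (smult c q)"
    using \<open>Rings.coprime p q\<close> c unfolding Rings.coprime_def by (simp add: dvd_smult_iff)
  moreover have "lead_coeff (smult c q) = 1" using q by (simp add: c_def)
  moreover have "r = Fract (smult c p) (smult c q)"
    using q c by (simp add: eq_fract mult.commute)
  ultimately show ?thesis by blast
qed

lemma num_den:
  fixes r :: "'k::field ratfun"
  shows "Rings.coprime (fst (num_den r)) (snd (num_den r))"
    and "lead_coeff (snd (num_den r)) = 1"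
    and "r = Fract (fst (num_den r)) (snd (num_den r))"
proof -
  have "\<exists>x. case x of (p, q) \<Rightarrow> Rings.coprime p q \<and> lead_coeff q = 1 \<and> r = Fract p q"
    using num_den_exists[of r] by auto
  from someI_ex[OF this]
  have "case num_den r of (p, q) \<Rightarrow> Rings.coprime p q \<and> lead_coeff q = 1 \<and> r = Fract p q"
    unfolding num_den_def .
  thus "Rings.coprime (fst (num_den r)) (snd (num_den r))" "lead_coeff (snd (num_den r)) = 1"
    "r = Fract (fst (num_den r)) (snd (num_den r))"
    by (auto simp: case_prod_unfold)
qed

text \<open>Evaluation happens in lowest terms, so removable singularities are removed; the value
  at a pole is 0 by convention.\<close>

definition ratfun_eval :: "'k::field ratfun \<Rightarrow> 'k \<Rightarrow> 'k" where
  "ratfun_eval r x = poly (fst (num_den r)) x / poly (snd (num_den r)) x"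

definition ratfun_zeros :: "'k::field ratfun \<Rightarrow> 'k multiset" where
  "ratfun_zeros r = proots (fst (num_den r))"

definition ratfun_poles :: "'k::field ratfun \<Rightarrow> 'k multiset" where
  "ratfun_poles r = proots (snd (num_den r))"

definition ratfun_to_ac :: "'k::field ratfun \<Rightarrow> 'k alg_closure ratfun" where
  "ratfun_to_ac \<phi> =
     Fract (map_poly to_ac (fst (num_den \<phi>))) (map_poly to_ac (snd (num_den \<phi>)))"

definition critical_points :: "'k::field ratfun \<Rightarrow> 'k alg_closure multiset" where
  "critical_points \<phi> = ratfun_zeros (ratfun_to_ac \<phi>) + ratfun_poles (ratfun_to_ac \<phi>)"

text \<open>Meaningful only for critical points of \<open>\<phi>\<close>, each of which is either a zero or
  a pole, but not both.\<close>

definition crit_sign :: "'k::field ratfun \<Rightarrow> 'k alg_closure \<Rightarrow> int" where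
  "crit_sign \<phi> \<alpha> = (if \<alpha> \<in># ratfun_zeros (ratfun_to_ac \<phi>) then 1 else - 1)"

definition weighted_sum :: "'k::field ratfun \<Rightarrow> 'k alg_closure multiset \<Rightarrow> int" where
  "weighted_sum \<phi> S = (\<Sum>\<alpha>\<in>#S. crit_sign \<phi> \<alpha>)"

definition S_part :: "'k::field ratfun \<Rightarrow> 'k alg_closure multiset \<Rightarrow> 'k alg_closure ratfun" where
  "S_part \<phi> S = (\<Prod>\<alpha>\<in>#S. Fract [:- \<alpha>, 1:] 1 powi crit_sign \<phi> \<alpha>)"

end

theory Submission
  imports Defs
begin

text \<open>
  Over the algebraic closure, \<open>\<phi>\<close> is a constant times a product of factors
  \<open>(X - \<alpha>)\<^sup>\<plusminus>\<^sup>1\<close>. Every value \<open>u (\<alpha> - s)\<close> lies in the divisible hull of the value group, so by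
  convexity it is either above \<open>\<Delta>\<close> or below \<open>\<Delta>\<close>. For \<open>t \<in> C\<close> the ultrametric inequality gives
  \<open>u (t - \<alpha>) = u (t - s)\<close> in the first case and \<open>u (t - \<alpha>) = u (s - \<alpha>)\<close> in the second.
\<close>

section \<open>Valuations\<close>

context
  fixes u :: "'k::field \<Rightarrow> 'g::linordered_ab_group_add vinf"
  assumes u: "is_valuation u"
begin

lemma valuation_Infty_iff: "u x = Infty \<longleftrightarrow> x = 0"
  and valuation_mult: "u (x * y) = u x + u y"
  and valuation_add_ge: "min (u x) (u y) \<le> u (x + y)"
  using u by (auto simp: is_valuation_def)

lemma valuation_nonzeroE:
  assumes "x \<noteq> 0"
  obtains g where "u x = Val g"
  using assms valuation_Infty_iff[of x] by (cases "u x") auto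

lemma valuation_1: "u 1 = Val 0"
proof -
  obtain g where "u 1 = Val g" by (rule valuation_nonzeroE[of 1]) simp
  thus ?thesis using valuation_mult[of 1 1] by simp
qed

text \<open>Since \<open>(- 1) * (- 1) = 1\<close>, twice the value of \<open>- 1\<close> is
  \<open>0\<close>, and an ordered group has no 2-torsion.\<close>

lemma valuation_uminus: "u (- x) = u x"
proof -
  obtain g where g: "u (- 1) = Val g" by (rule valuation_nonzeroE[of "- 1"]) simp
  have "g + g = 0" using valuation_mult[of "- 1" "- 1"] g by (simp add: valuation_1)
  hence "u (- 1) = Val 0" using g by simp
  thus ?thesis using valuation_mult[of "- 1" x] by (cases "u x") simp_all
qed

lemma valuation_diff_commute: "u (x - y) = u (y - x)"
  using valuation_uminus[of "x - y"] by simp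

text \<open>For the upper bound write \<open>x = (x + y) - y\<close>: because \<open>u y\<close>
  exceeds \<open>u x\<close>, the term of the minimum lying below \<open>u x\<close> must be
  \<open>u (x + y)\<close>.\<close>

lemma valuation_add_eq:
  assumes "u x < u y"
  shows "u (x + y) = u x"
proof (rule antisym)
  have "min (u (x + y)) (u y) \<le> u x"
    using valuation_add_ge[of "x + y" "- y"] by (simp add: valuation_uminus)
  with assms show "u (x + y) \<le> u x" by (auto simp: min_def split: if_splits)
next
  show "u x \<le> u (x + y)" using valuation_add_ge[of x y] assms by (simp add: min_absorb1)
qed

lemma valuation_add_cases:
  assumes "u x \<noteq> u y"
  shows "u (x + y) = u x \<or> u (x + y) = u y"
  using assms valuation_add_eq[of x y] valuation_add_eq[of y x]
  by (auto simp: neq_iff add.commute)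

text \<open>Used to show that nonzero terms with pairwise distinct values cannot sum to zero;
  knowing which term gives the value is irrelevant for that.\<close>

lemma valuation_sum_in_image:
  assumes "finite I" "I \<noteq> {}" "inj_on (\<lambda>i. u (f i)) I"
  shows "u (\<Sum>i\<in>I. f i) \<in> (\<lambda>i. u (f i)) ` I"
  using assms
proof (induction I rule: finite_ne_induct)
  case (insert i I)
  hence IH: "u (\<Sum>i\<in>I. f i) \<in> (\<lambda>i. u (f i)) ` I" by simp
  hence "u (f i) \<noteq> u (\<Sum>i\<in>I. f i)" using insert by auto
  from valuation_add_cases[OF this] IH insert show ?case by auto
qed simp

lemma valuation_mult_cong: "u a = u a' \<Longrightarrow> u b = u b' \<Longrightarrow> u (a * b) = u (a' * b')"
  by (simp add: valuation_mult)

lemma valuation_inverse: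
  assumes "u x = Val g"
  shows "u (inverse x) = Val (- g)"
proof -
  have x: "x \<noteq> 0" using assms valuation_Infty_iff[of x] by auto
  then obtain h where h: "u (inverse x) = Val h" by (metis valuation_nonzeroE inverse_nonzero_iff_nonzero)
  have "g + h = 0" using valuation_mult[of x "inverse x"] x assms h by (simp add: valuation_1)
  thus ?thesis using h by (simp add: eq_neg_iff_add_eq_0 add.commute)
qed

lemma valuation_divide_cong:
  assumes "u a = u a'" "u b = u b'"
  shows "u (a / b) = u (a' / b')"
proof (cases "b = 0")
  case True
  \<comment> \<open>Equal values force \<open>b' = 0\<close> as well, and division by zero returns
    \<open>0\<close> on both sides.\<close>
  thus ?thesis using assms valuation_Infty_iff by (metis div_by_0)
next
  case False
  then obtain g where "u b = Val g" by (rule valuation_nonzeroE)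
  hence "u (inverse b) = u (inverse b')" using assms(2) by (simp add: valuation_inverse)
  thus ?thesis using assms by (simp add: divide_inverse valuation_mult)
qed

lemma valuation_prod_mset_cong:
  assumes "\<And>x. x \<in># A \<Longrightarrow> u (f x) = u (g x)"
  shows "u (\<Prod>x\<in>#A. f x) = u (\<Prod>x\<in>#A. g x)"
  using assms by (induction A) (auto simp: valuation_mult)

lemma valuation_power:
  assumes "u x = Val g"
  shows "u (x ^ n) = Val (iterate_add n g)"
  using assms by (induction n) (auto simp: valuation_1 valuation_mult)

text \<open>Finiteness of \<open>u x\<close> matters: for \<open>x = 0\<close> and
  \<open>n = 0\<close> the left side is \<open>Val 0\<close>, whereas
  \<open>vinf_mult 0 Infty = Infty\<close>.\<close>

lemma valuation_powi:
  assumes "u x = Val g"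
  shows "u (x powi n) = vinf_mult n (u x)"
  using assms by (simp add: power_int_def int_mult_def power_inverse valuation_inverse valuation_power)

end

text \<open>
  A vanishing polynomial expression must have two terms of equal value, which exhibits
  a positive multiple of \<open>u x\<close> as a difference of values of coefficients.
\<close>

lemma alg_closure_value_in_rational_value_group:
  fixes u :: "'k::field alg_closure \<Rightarrow> 'g::linordered_ab_group_add vinf"
  assumes ext: "extends_valuation u v" and x: "u x = Val g"
  shows "g \<in> rational_value_group v"
proof -
  have u: "is_valuation u" and uv: "\<And>a. u (to_ac a) = v a"
    using ext by (auto simp: extends_valuation_def)
  obtain p :: "'k poly" where p: "p \<noteq> 0" "poly (map_poly to_ac p) x = 0"
    by (rule alg_closure_algebraic)
  define f where "f i = to_ac (coeff p i) * x ^ i" for i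
  \<comment> \<open>Without the zero coefficients, every remaining term has finite value.\<close>
  define I where "I = {i. i \<le> degree p \<and> coeff p i \<noteq> 0}"
  have x0: "x \<noteq> 0" using x valuation_Infty_iff[OF u, of x] by auto
  have I: "finite I" "I \<noteq> {}" using p by (auto simp: I_def intro!: exI[of _ "degree p"])
  have "degree (map_poly to_ac p) = degree p" by (rule degree_map_poly) simp
  hence "(\<Sum>i\<le>degree p. f i) = 0"
    using p by (simp add: poly_altdef coeff_map_poly f_def)
  also have "(\<Sum>i\<le>degree p. f i) = (\<Sum>i\<in>I. f i)"
    by (rule sum.mono_neutral_right) (auto simp: I_def f_def)
  finally have "(\<Sum>i\<in>I. f i) = 0" .
  hence "u (\<Sum>i\<in>I. f i) = Infty" by (simp add: valuation_Infty_iff[OF u])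
  moreover have "u (f i) \<noteq> Infty" if "i \<in> I" for i
    using that x0 by (simp add: valuation_Infty_iff[OF u] f_def I_def)
  ultimately have "\<not> inj_on (\<lambda>i. u (f i)) I"
    using valuation_sum_in_image[OF u I, of f] by force
  then obtain i j where ij: "i \<in> I" "j \<in> I" "i < j" "u (f i) = u (f j)"
    unfolding inj_on_def by (metis nat_neq_iff)
  define a b where "a = coeff p i" and "b = coeff p j"
  have ab: "a \<noteq> 0" "b \<noteq> 0" using ij by (auto simp: I_def a_def b_def)
  \<comment> \<open>Dividing the equally valued \<open>f i\<close> and \<open>f j\<close> by
    \<open>to_ac b * x ^ i\<close> leaves \<open>to_ac (a / b)\<close> and
    \<open>x ^ (j - i)\<close>.\<close>
  have "u (to_ac (a / b)) = u (f i / (to_ac b * x ^ i))"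
    using ab x0 by (simp add: f_def a_def)
  also have "\<dots> = u (f j / (to_ac b * x ^ i))"
    using ij by (intro valuation_divide_cong[OF u]) simp_all
  also have "f j / (to_ac b * x ^ i) = x ^ (j - i)"
    using ab x0 ij by (simp add: f_def b_def power_diff)
  finally have "v (a / b) = Val (iterate_add (j - i) g)"
    unfolding uv by (simp add: valuation_power[OF u x])
  thus ?thesis using ij by (auto simp: rational_value_group_def value_group_def intro!: exI[of _ "j - i"])
qed

section \<open>Rational functions\<close>

lemma num_den_cross_mult:
  fixes p q :: "'k::field poly"
  assumes "q \<noteq> 0"
  shows "p * snd (num_den (Fract p q)) = fst (num_den (Fract p q)) * q"
proof -
  have "snd (num_den (Fract p q)) \<noteq> 0" using num_den(2)[of "Fract p q"] by auto
  thus ?thesis using num_den(3)[of "Fract p q"] assms eq_fract(1) by metis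
qed

lemma coprime_imp_no_common_root:
  fixes p q :: "'k::field poly"
  assumes "Rings.coprime p q" "poly p x = 0" "poly q x = 0"
  shows False
proof -
  have "is_unit [:- x, 1:]"
    using assms by (intro coprime_common_divisor[of p q]) (simp_all add: poly_eq_0_iff_dvd)
  thus False by (simp add: is_unit_iff_degree)
qed

text \<open>Allows evaluation without knowing the reduced form that \<open>num_den\<close>
  selects.\<close>

lemma ratfun_eval_Fract:
  fixes p q :: "'k::field poly"
  assumes "poly q x \<noteq> 0"
  shows "ratfun_eval (Fract p q) x = poly p x / poly q x"
proof -
  let ?p = "fst (num_den (Fract p q))" and ?q = "snd (num_den (Fract p q))"
  have "q \<noteq> 0" using assms by auto
  hence eq: "poly p x * poly ?q x = poly ?p x * poly q x"
    using arg_cong[OF num_den_cross_mult, of q "\<lambda>r. poly r x" p] by simp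
  \<comment> \<open>If \<open>?q\<close> vanished at \<open>x\<close>, then \<open>eq\<close> would
    make the coprime \<open>?p\<close> vanish there too.\<close>
  have "poly ?q x \<noteq> 0"
    using eq assms coprime_imp_no_common_root[OF num_den(1)] by fastforce
  thus ?thesis using eq assms by (simp add: ratfun_eval_def field_simps)
qed

section \<open>Passage from the base field to its algebraic closure\<close>

lemma poly_map_poly_to_ac: "poly (map_poly to_ac p) (to_ac x) = to_ac (poly p x)"
  by (induction p) (simp_all add: map_poly_pCons)

lemma map_poly_to_ac_eq_0_iff: "map_poly to_ac p = 0 \<longleftrightarrow> p = 0"
  by (simp add: map_poly_eq_0_iff)

lemma ratfun_eval_ratfun_to_ac:
  assumes "poly (snd (num_den (ratfun_to_ac \<phi>))) (to_ac x) \<noteq> 0"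
  shows "ratfun_eval (ratfun_to_ac \<phi>) (to_ac x) = to_ac (ratfun_eval \<phi> x)"
proof -
  let ?p = "fst (num_den \<phi>)" and ?q = "snd (num_den \<phi>)"
  let ?P = "fst (num_den (ratfun_to_ac \<phi>))" and ?Q = "snd (num_den (ratfun_to_ac \<phi>))"
  have "?q \<noteq> 0" using num_den(2)[of \<phi>] by auto
  hence "map_poly to_ac ?p * ?Q = ?P * map_poly to_ac ?q"
    unfolding ratfun_to_ac_def by (intro num_den_cross_mult) (simp add: map_poly_to_ac_eq_0_iff)
  from arg_cong[OF this, of "\<lambda>r. poly r (to_ac x)"]
  have "to_ac (poly ?p x) * poly ?Q (to_ac x) = poly ?P (to_ac x) * to_ac (poly ?q x)"
    by (simp add: poly_map_poly_to_ac)
  \<comment> \<open>A root of \<open>?q\<close> at \<open>x\<close> would, as \<open>?Q\<close> does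
    not vanish, be a root of \<open>?p\<close> as well.\<close>
  hence "poly ?q x \<noteq> 0"
    using assms coprime_imp_no_common_root[OF num_den(1)[of \<phi>]] by fastforce
  thus ?thesis
    unfolding ratfun_to_ac_def
    by (subst ratfun_eval_Fract) (simp_all add: poly_map_poly_to_ac ratfun_eval_def)
qed

lemma ratfun_to_ac_eq_0_iff: "ratfun_to_ac \<phi> = 0 \<longleftrightarrow> \<phi> = 0"
proof -
  have "snd (num_den \<phi>) \<noteq> 0" using num_den(2)[of \<phi>] by auto
  hence "map_poly to_ac (snd (num_den \<phi>)) \<noteq> 0" by (simp add: map_poly_to_ac_eq_0_iff)
  hence "ratfun_to_ac \<phi> = 0 \<longleftrightarrow> map_poly to_ac (fst (num_den \<phi>)) = 0"
    by (simp add: ratfun_to_ac_def Zero_fract_def eq_fract)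
  also have "\<dots> \<longleftrightarrow> fst (num_den \<phi>) = 0" by (rule map_poly_to_ac_eq_0_iff)
  also have "\<dots> \<longleftrightarrow> \<phi> = 0"
    by (subst (2) num_den(3)) (simp add: Zero_fract_def eq_fract \<open>snd (num_den \<phi>) \<noteq> 0\<close>)
  finally show ?thesis .
qed

text \<open>The multiset of any factorization into linear factors is recovered as the multiset of
  roots.\<close>

lemma alg_closed_proots_factorization:
  fixes p :: "'a::alg_closed_field poly"
  assumes "p \<noteq> 0"
  shows "p = smult (lead_coeff p) (\<Prod>x\<in>#proots p. [:- x, 1:])"
proof -
  obtain A where A: "p = smult (lead_coeff p) (\<Prod>x\<in>#A. [:- x, 1:])"
    using alg_closed_imp_factorization[OF assms] by blast
  have "proots (\<Prod>x\<in>#B. [:- x, 1:]) = B" for B :: "'a multiset"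
  proof (induction B)
    case (add b B)
    have "(\<Prod>x\<in>#B. [:- x, 1:]) \<noteq> 0" by (auto simp: prod_mset_zero_iff)
    thus ?case using add by (simp add: proots_mult del: mult_pCons_left)
  qed simp
  hence "proots p = A" using assms by (subst A) simp
  thus ?thesis using A by simp
qed

lemma prod_mset_Fract_1: "(\<Prod>x\<in>#A. Fract (f x) 1) = Fract (\<Prod>x\<in>#A. f x) (1 :: 'a::idom)"
  by (induction A) (simp_all add: One_fract_def)

lemma prod_mset_inverse: "(\<Prod>x\<in>#A. inverse (f x)) = inverse (\<Prod>x\<in>#A. f x :: 'a::field)"
  by (induction A) simp_all

lemma poly_prod_mset_linear:
  "poly (\<Prod>a\<in>#A. [:- a, 1:]) x = (\<Prod>a\<in>#A. x - a :: 'a::comm_ring_1)"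
  by (induction A) (simp_all add: algebra_simps)

text \<open>\<open>crit_sign\<close> only tests for zeros, so it suffices that \<open>B\<close>
  avoids them; in use \<open>B\<close> consists of poles.\<close>

lemma weighted_sum_zeros_poles:
  assumes "set_mset A \<subseteq> set_mset (ratfun_zeros (ratfun_to_ac \<phi>))"
    and "set_mset B \<inter> set_mset (ratfun_zeros (ratfun_to_ac \<phi>)) = {}"
  shows "weighted_sum \<phi> (A + B) = int (size A) - int (size B)"
proof -
  have "image_mset (crit_sign \<phi>) A = image_mset (\<lambda>_. 1) A"
    using assms by (intro image_mset_cong) (auto simp: crit_sign_def)
  moreover have "image_mset (crit_sign \<phi>) B = image_mset (\<lambda>_. - 1) B"
    using assms by (intro image_mset_cong) (auto simp: crit_sign_def)
  ultimately show ?thesis by (simp add: weighted_sum_def)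
qed

lemma S_part_zeros_poles:
  assumes "set_mset A \<subseteq> set_mset (ratfun_zeros (ratfun_to_ac \<phi>))"
    and "set_mset B \<inter> set_mset (ratfun_zeros (ratfun_to_ac \<phi>)) = {}"
  shows "S_part \<phi> (A + B) = Fract (\<Prod>a\<in>#A. [:- a, 1:]) (\<Prod>b\<in>#B. [:- b, 1:])"
proof -
  let ?F = "\<lambda>\<alpha>. Fract [:- \<alpha>, 1:] 1"
  have "image_mset (\<lambda>\<alpha>. ?F \<alpha> powi crit_sign \<phi> \<alpha>) A = image_mset ?F A"
    using assms by (intro image_mset_cong) (auto simp: crit_sign_def)
  moreover have "image_mset (\<lambda>\<alpha>. ?F \<alpha> powi crit_sign \<phi> \<alpha>) B = image_mset (\<lambda>\<alpha>. inverse (?F \<alpha>)) B"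
    using assms by (intro image_mset_cong) (auto simp: crit_sign_def power_int_minus)
  ultimately have "S_part \<phi> (A + B) = (\<Prod>\<alpha>\<in>#A. ?F \<alpha>) * (\<Prod>\<alpha>\<in>#B. inverse (?F \<alpha>))"
    by (simp add: S_part_def del: inverse_fract)
  also have "\<dots> = Fract (\<Prod>a\<in>#A. [:- a, 1:]) (\<Prod>b\<in>#B. [:- b, 1:])"
    unfolding prod_mset_inverse by (simp add: prod_mset_Fract_1)
  finally show ?thesis .
qed

section \<open>The value of a rational function on an annulus\<close>

theorem theorem3p3:
  fixes V :: "'k::field set"
    and v :: "'k \<Rightarrow> 'g::linordered_ab_group_add vinf"
    and u :: "'k alg_closure \<Rightarrow> 'g vinf"
    and \<phi> :: "'k ratfun"
    and s :: 'k
    and \<Delta> :: "'g set"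
    and C :: "'k alg_closure set"
    and S :: "'k alg_closure multiset"
    and l :: int
    and \<gamma> :: "'g vinf"
  assumes "valuation_domain V"
    and "valuation_of V v"
    and "\<phi> \<noteq> 0"
    and "extends_valuation u v"
    and "convex_subset \<Delta> (rational_value_group v)"
    and "C = annulus u s \<Delta>"
    and "\<forall>\<alpha>. \<alpha> \<in># critical_points \<phi> \<longrightarrow> \<alpha> \<notin> C"
    and "S = {#\<alpha> \<in># critical_points \<phi>. above (u (\<alpha> - to_ac s)) \<Delta>#}"
    and "l = weighted_sum \<phi> S"
    and "\<gamma> = u (ratfun_eval (ratfun_to_ac \<phi> / S_part \<phi> S) (to_ac s))"
  shows "\<forall>t. to_ac t \<in> C \<longrightarrow> v (ratfun_eval \<phi> t) = vinf_mult l (v (t - s)) + \<gamma>"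
proof (intro allI impI)
  fix t assume t: "to_ac t \<in> C"
  let ?s = "to_ac s" and ?t = "to_ac t"
  let ?above = "\<lambda>\<alpha>. above (u (\<alpha> - ?s)) \<Delta>"
  have u: "is_valuation u" and uv: "\<And>a. u (to_ac a) = v a"
    using assms(4) by (auto simp: extends_valuation_def)
  obtain d where d: "d \<in> \<Delta>" "u (?t - ?s) = Val d"
    using t assms(6) by (auto simp: annulus_def)
  have ts: "?t - ?s \<noteq> 0" using d(2) valuation_Infty_iff[OF u, of "?t - ?s"] by force

  define N D where "N = fst (num_den (ratfun_to_ac \<phi>))" and "D = snd (num_den (ratfun_to_ac \<phi>))"
  have D: "lead_coeff D = 1" "D \<noteq> 0" using num_den(2)[of "ratfun_to_ac \<phi>"] by (auto simp: D_def)
  have ND: "ratfun_to_ac \<phi> = Fract N D" and cop: "Rings.coprime N D"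
    using num_den(1,3)[of "ratfun_to_ac \<phi>"] by (auto simp: N_def D_def)
  have N: "N \<noteq> 0"
    using assms(3) ND ratfun_to_ac_eq_0_iff[of \<phi>] by (auto simp: fract_collapse)
  define A B where "A = proots N" and "B = proots D"
  have zeros: "ratfun_zeros (ratfun_to_ac \<phi>) = A" and poles: "ratfun_poles (ratfun_to_ac \<phi>) = B"
    by (simp_all add: ratfun_zeros_def ratfun_poles_def A_def B_def N_def D_def)
  have disj: "set_mset B \<inter> set_mset A = {}"
    using N D coprime_imp_no_common_root[OF cop] by (auto simp: A_def B_def)
  \<comment> \<open>Index 1 collects the zeros and poles that make up \<open>S\<close>, index 2 the
    remaining ones.\<close>
  define A1 A2 B1 B2 where "A1 = filter_mset ?above A" and "A2 = filter_mset (\<lambda>\<alpha>. \<not> ?above \<alpha>) A"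
    and "B1 = filter_mset ?above B" and "B2 = filter_mset (\<lambda>\<alpha>. \<not> ?above \<alpha>) B"
  have A: "A = A1 + A2" and B: "B = B1 + B2"
    by (simp_all add: A1_def A2_def B1_def B2_def)
  have S: "S = A1 + B1"
    by (simp add: assms(8) critical_points_def zeros poles A1_def B1_def)
  have sub: "set_mset A1 \<subseteq> set_mset (ratfun_zeros (ratfun_to_ac \<phi>))"
    "set_mset B1 \<inter> set_mset (ratfun_zeros (ratfun_to_ac \<phi>)) = {}"
    using disj by (auto simp: zeros A1_def B1_def)
  have l: "l = int (size A1) - int (size B1)"
    unfolding assms(9) S by (rule weighted_sum_zeros_poles[OF sub])

  \<comment> \<open>Here \<open>?t - \<alpha>\<close> splits as
    \<open>(?t - ?s) + (?s - \<alpha>)\<close>, and the first summand has the smaller value.\<close>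
  have near: "u (?t - \<alpha>) = u (?t - ?s)" if "?above \<alpha>" for \<alpha>
  proof -
    have "u (?t - ?s) < u (?s - \<alpha>)"
      using that d by (simp add: above_def valuation_diff_commute[OF u, of ?s])
    from valuation_add_eq[OF u this] show ?thesis by simp
  qed
  have far: "u (?t - \<alpha>) = u (?s - \<alpha>)" if "\<alpha> \<in># A + B" "\<not> ?above \<alpha>" for \<alpha>
  proof -
    have "\<alpha> \<notin> C" using that assms(7) by (auto simp: critical_points_def zeros poles)
    obtain e where e: "e \<in> \<Delta>" "\<not> Val e < u (\<alpha> - ?s)"
      using \<open>\<not> ?above \<alpha>\<close> by (auto simp: above_def)
    \<comment> \<open>In particular \<open>\<alpha>\<close> differs from \<open>?s\<close>, since
      \<open>Infty\<close> lies above every \<open>Val e\<close>.\<close>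
    then obtain g where g: "u (\<alpha> - ?s) = Val g" "g \<le> e"
      by (cases "u (\<alpha> - ?s)") auto
    have "g \<notin> \<Delta>" using \<open>\<alpha> \<notin> C\<close> g by (auto simp: assms(6) annulus_def)
    moreover have "g \<in> rational_value_group v"
      by (rule alg_closure_value_in_rational_value_group[OF assms(4) g(1)])
    \<comment> \<open>Otherwise \<open>g\<close> would lie between \<open>d\<close> and
      \<open>e\<close>, hence in \<Delta> by convexity.\<close>
    ultimately have "\<not> d \<le> g"
      using assms(5) d(1) e(1) g(2) unfolding convex_subset_def by blast
    hence "u (?s - \<alpha>) < u (?t - ?s)"
      using d g by (simp add: valuation_diff_commute[OF u, of ?s])
    from valuation_add_eq[OF u this] show ?thesis by simp
  qed

  \<comment> \<open>As \<open>D\<close> is monic, \<open>c\<close> is the only scalar in the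
    factorization of the quotient.\<close>
  define c where "c = lead_coeff N"
  let ?L = "\<lambda>A. \<Prod>a\<in>#A. [:- a, 1:]" and ?E = "\<lambda>A x. \<Prod>a\<in>#A. x - a"
  have L: "?L M \<noteq> 0" for M :: "'k alg_closure multiset" by (auto simp: prod_mset_zero_iff)
  have Nf: "N = smult c (?L A1 * ?L A2)"
    using alg_closed_proots_factorization[OF N] by (simp add: c_def A_def[symmetric] A)
  have Df: "D = ?L B1 * ?L B2"
    using alg_closed_proots_factorization[OF D(2)] D(1) by (simp add: B_def[symmetric] B)

  have "poly D ?t \<noteq> 0"
  proof
    assume "poly D ?t = 0"
    hence "?t \<in># critical_points \<phi>" using D(2) by (simp add: critical_points_def poles B_def)
    thus False using t assms(7) by blast
  qed
  hence "v (ratfun_eval \<phi> t) = u (ratfun_eval (ratfun_to_ac \<phi>) ?t)"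
    unfolding D_def by (simp add: ratfun_eval_ratfun_to_ac uv)
  also have "\<dots> = u (poly N ?t / poly D ?t)" by (simp add: ratfun_eval_def N_def D_def)
  also have "\<dots> = u ((c * (?E A1 ?t * ?E A2 ?t)) / (?E B1 ?t * ?E B2 ?t))"
    unfolding Nf Df by (simp add: poly_prod_mset_linear)
  \<comment> \<open>Only values are preserved here: \<open>near\<close> replaces the factors of
    index 1 and \<open>far\<close> those of index 2.\<close>
  also have "\<dots> = u ((c * ((\<Prod>a\<in>#A1. ?t - ?s) * ?E A2 ?s)) / ((\<Prod>b\<in>#B1. ?t - ?s) * ?E B2 ?s))"
    by (intro valuation_divide_cong[OF u] valuation_mult_cong[OF u] valuation_prod_mset_cong[OF u] refl
        near far) (auto simp: A1_def A2_def B1_def B2_def)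
  also have "(c * ((\<Prod>a\<in>#A1. ?t - ?s) * ?E A2 ?s)) / ((\<Prod>b\<in>#B1. ?t - ?s) * ?E B2 ?s)
      = (?t - ?s) powi l * (c * ?E A2 ?s / ?E B2 ?s)"
    unfolding l using ts by (simp add: power_int_diff)
  also have "u \<dots> = vinf_mult l (u (?t - ?s)) + u (c * ?E A2 ?s / ?E B2 ?s)"
    by (simp only: valuation_mult[OF u] valuation_powi[OF u d(2)])
  also have "u (?t - ?s) = v (t - s)" using uv[of "t - s"] by simp
  also have "u (c * ?E A2 ?s / ?E B2 ?s) = \<gamma>"
  proof -
    have "ratfun_to_ac \<phi> / S_part \<phi> S = Fract (N * ?L B1) (D * ?L A1)"
      unfolding S S_part_zeros_poles[OF sub] by (simp add: ND)
    also have "\<dots> = Fract (smult c (?L A2)) (?L B2)"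
      using L D(2) by (subst eq_fract(1)) (simp_all add: Nf Df mult_ac)
    finally have eq: "ratfun_to_ac \<phi> / S_part \<phi> S = Fract (smult c (?L A2)) (?L B2)" .
    \<comment> \<open>A pole at \<open>?s\<close> would have
      \<open>u (\<alpha> - ?s) = Infty\<close>, which is above \<Delta>, so it would belong to
      \<open>B1\<close>.\<close>
    have "?E B2 ?s \<noteq> 0"
      by (auto simp: prod_mset_zero_iff B2_def above_def valuation_Infty_iff[OF u, THEN iffD2])
    thus ?thesis
      unfolding assms(10) eq by (subst ratfun_eval_Fract) (simp_all add: poly_prod_mset_linear)
  qed
  finally show "v (ratfun_eval \<phi> t) = vinf_mult l (v (t - s)) + \<gamma>" .
qed

end
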